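(* Let $H_1$ and $H_2$ be Hilbert spaces and let $K$ be a compact Hausdorff topological space. Then the pair $(H_1\times H_2,C(K))$ has the Bishop-Phelps-Bollobás point property for compact bilinear mappings.
   Context: All spaces are over the same scalar field $\mathbb{K}$, which is $\mathbb{R}$ or $\mathbb{C}$. $S_X$ and $B_X$ are the unit sphere and closed unit ball of $X$. $C(K)$ is the space of continuous scalar-valued functions on $K$ with the supremum norm. A bilinear mapping $B:X\times Y\to Z$ between Banach spaces is compact if $B(B_X\times B_Y)$ is precompact (relatively compact) in $Z$; $\mathcal{K}(X\times Y,Z)$ denotes the set of all compact bilinear mappings, with norm $\|B\|=\sup\{\|B(x,y)\|:x\in B_X,\,y\in B_Y\}$. The pair $(X\times Y,Z)$ has the Bishop-Phelps-Bollobás point property (BPBpp) for compact bilinear mappings if for every $\varepsilon>0$ there exists $\eta(\varepsilon)>0$ such that whenever $B\in\mathcal{K}(X\times Y,Z)$ with $\|B\|=1$ and $(x_0,y_0)\in S_X\times S_Y$ satisfy $\|B(x_0,y_0)\|>1-\eta(\varepsilon)$, there exists $A\in\mathcal{K}(X\times Y,Z)$ with $\|A\|=1$ such that $\|A(x_0,y_0)\|=1$ and $\|A-B\|<\varepsilon$. *)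

theory Defs
  imports "HOL-Analysis.Analysis"
begin

text \<open>
  Real Hilbert spaces are the types of class \<open>real_inner\<close> and \<open>complete_space\<close>.  There is no
  complex counterpart in the library, so it is introduced here: a complex Hilbert space is a
  Banach space whose real structure is the restriction of a complex one and whose norm comes from
  a complex inner product, linear in the first argument.
\<close>

class complex_hilbert = banach +
  fixes scaleC :: "complex \<Rightarrow> 'a \<Rightarrow> 'a"  (infixr \<open>*\<^sub>C\<close> 75)
    and cinner :: "'a \<Rightarrow> 'a \<Rightarrow> complex"
  assumes scaleC_add_right: "c *\<^sub>C (x + y) = c *\<^sub>C x + c *\<^sub>C y"
    and scaleC_add_left: "(c + d) *\<^sub>C x = c *\<^sub>C x + d *\<^sub>C x"
    and scaleC_scaleC: "c *\<^sub>C d *\<^sub>C x = (c * d) *\<^sub>C x"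
    and scaleC_of_real: "complex_of_real r *\<^sub>C x = r *\<^sub>R x"
    and cinner_add_left: "cinner (x + y) z = cinner x z + cinner y z"
    and cinner_scaleC_left: "cinner (c *\<^sub>C x) y = c * cinner x y"
    and cinner_commute: "cinner x y = cnj (cinner y x)"
    and cinner_self: "cinner x x = complex_of_real ((norm x)\<^sup>2)"

lemma vector_space_scaleC: "vector_space (scaleC :: complex \<Rightarrow> 'a::complex_hilbert \<Rightarrow> 'a)"
proof
  show "1 *\<^sub>C x = x" for x :: 'a
    using scaleC_of_real[of 1 x] by simp
qed (simp_all add: scaleC_add_right scaleC_add_left scaleC_scaleC)

text \<open>
  For a compact Hausdorff type \<open>'k\<close>, the space \<open>C(K)\<close> is \<open>'k \<Rightarrow>\<^sub>C real\<close> or \<open>'k \<Rightarrow>\<^sub>C complex\<close>, with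
  the supremum norm; boundedness is automatic.  The library provides only real scalar
  multiplication on these types.
\<close>

context includes bcontfun.lifting
begin

lift_definition scale_bcontfun ::
    "'s::real_normed_field \<Rightarrow> ('k::topological_space \<Rightarrow>\<^sub>C 's) \<Rightarrow> ('k \<Rightarrow>\<^sub>C 's)"
  is "\<lambda>c f t. c * f t"
proof -
  fix c :: 's and f :: "'k \<Rightarrow> 's"
  assume f: "f \<in> bcontfun"
  have "bounded ((*) c ` range f)"
    using f by (intro bounded_linear_image bounded_linear_mult_right) (simp add: bcontfun_def)
  moreover have "continuous_on UNIV (\<lambda>t. c * f t)"
    using f by (intro continuous_intros) (simp add: bcontfun_def)
  ultimately show "(\<lambda>t. c * f t) \<in> bcontfun"
    by (simp add: bcontfun_def image_image)
qed

lemma vector_space_scale_bcontfun: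
  "vector_space (scale_bcontfun :: 's::real_normed_field \<Rightarrow> ('k::topological_space \<Rightarrow>\<^sub>C 's) \<Rightarrow> _)"
  by standard (transfer; simp add: fun_eq_iff algebra_simps)+

lemma scale_bcontfun_real:
  "scale_bcontfun = (scaleR :: real \<Rightarrow> ('k::topological_space \<Rightarrow>\<^sub>C real) \<Rightarrow> _)"
  by (intro ext) (transfer; simp)

end

text \<open>
  The scalar multiplications \<open>sX\<close>, \<open>sY\<close>, \<open>sZ\<close> are parameters, so that the notions below cover
  both scalar fields.
\<close>

definition bilinear_map ::
    "('s::field \<Rightarrow> 'x::ab_group_add \<Rightarrow> 'x) \<Rightarrow> ('s \<Rightarrow> 'y::ab_group_add \<Rightarrow> 'y) \<Rightarrow>
     ('s \<Rightarrow> 'z::ab_group_add \<Rightarrow> 'z) \<Rightarrow> ('x \<Rightarrow> 'y \<Rightarrow> 'z) \<Rightarrow> bool"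
  where "bilinear_map sX sY sZ B \<longleftrightarrow>
    (\<forall>x. Vector_Spaces.linear sY sZ (B x)) \<and> (\<forall>y. Vector_Spaces.linear sX sZ (\<lambda>x. B x y))"

definition compact_bilinear ::
    "('s::field \<Rightarrow> 'x::real_normed_vector \<Rightarrow> 'x) \<Rightarrow> ('s \<Rightarrow> 'y::real_normed_vector \<Rightarrow> 'y) \<Rightarrow>
     ('s \<Rightarrow> 'z::real_normed_vector \<Rightarrow> 'z) \<Rightarrow> ('x \<Rightarrow> 'y \<Rightarrow> 'z) set"
  where "compact_bilinear sX sY sZ =
    {B. bilinear_map sX sY sZ B \<and>
        compact (closure ((\<lambda>(x, y). B x y) ` (cball 0 1 \<times> cball 0 1)))}"

text \<open>
  The supremum is meaningful only for bounded bilinear maps; it is applied only to compact ones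
  and their differences.
\<close>

definition bilinear_norm ::
    "('x::real_normed_vector \<Rightarrow> 'y::real_normed_vector \<Rightarrow> 'z::real_normed_vector) \<Rightarrow> real"
  where "bilinear_norm B = (SUP (x, y) \<in> cball 0 1 \<times> cball 0 1. norm (B x y))"

definition BPBpp_compact_bilinear ::
    "('s::field \<Rightarrow> 'x::real_normed_vector \<Rightarrow> 'x) \<Rightarrow> ('s \<Rightarrow> 'y::real_normed_vector \<Rightarrow> 'y) \<Rightarrow>
     ('s \<Rightarrow> 'z::real_normed_vector \<Rightarrow> 'z) \<Rightarrow> bool"
  where "BPBpp_compact_bilinear sX sY sZ \<longleftrightarrow>
    (\<forall>\<epsilon>>0. \<exists>\<eta>>0. \<forall>B \<in> compact_bilinear sX sY sZ. \<forall>x\<^sub>0 \<in> sphere 0 1. \<forall>y\<^sub>0 \<in> sphere 0 1.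
       bilinear_norm B = 1 \<and> norm (B x\<^sub>0 y\<^sub>0) > 1 - \<eta> \<longrightarrow>
       (\<exists>A \<in> compact_bilinear sX sY sZ.
          bilinear_norm A = 1 \<and> norm (A x\<^sub>0 y\<^sub>0) = 1 \<and>
          bilinear_norm (\<lambda>x y. A x y - B x y) < \<epsilon>))"

end

theory Submission
  imports Defs
begin

text \<open>
  A map \<open>B\<close> into \<open>C(K)\<close> is a family of scalar forms \<open>B\<^sub>t\<close>, one for each point \<open>t\<close> of \<open>K\<close>.  If
  \<open>B(x\<^sub>0, y\<^sub>0)\<close> nearly attains the norm of \<open>B\<close>, then some value \<open>B\<^sub>s(x\<^sub>0, y\<^sub>0)\<close> does so, and it is
  enough to correct \<open>B\<close> near the point \<open>s\<close>.

  The correction of one form \<open>b = B\<^sub>s\<close> is explicit.  Split both Hilbert spaces orthogonally along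
  \<open>x\<^sub>0\<close> and \<open>y\<^sub>0\<close>.  With respect to these splittings \<open>b\<close> is a two by two block matrix whose corner
  entry \<open>c = b(x\<^sub>0, y\<^sub>0)\<close> has modulus near 1.  As \<open>b\<close> has norm at most 1, the two off-diagonal
  blocks have norm at most \<open>sqrt (1 - |c|\<^sup>2)\<close> (\<open>orthogonal_value_le\<close>), so they may be deleted, and
  \<open>c\<close> may be replaced by its phase \<open>c / |c|\<close>.  The new form \<open>a\<close> is block diagonal with blocks of
  norm at most 1; hence its norm is 1 and it is attained at \<open>(x\<^sub>0, y\<^sub>0)\<close>
  (\<open>form_correction\<close>).

  Compactness makes \<open>t \<mapsto> B\<^sub>t\<close> continuous in norm, so there is a continuous bump \<open>\<phi>\<close> with values in
  the unit interval and \<open>\<phi>(s) = 1\<close> that vanishes where \<open>B\<^sub>t\<close> is not close to \<open>B\<^sub>s\<close> (\<open>bump_function\<close>).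
  The family \<open>(1 - \<phi>(t)) B\<^sub>t + \<phi>(t) a\<close> consists of convex combinations of forms of norm at most
  1, equals \<open>a\<close> at \<open>s\<close>, and differs from \<open>B\<close> only where \<open>B\<^sub>t\<close>, \<open>B\<^sub>s\<close> and \<open>a\<close> are all close
  together.  It is again compact, since it is obtained from \<open>B\<close> by multiplication operators and a
  bilinear map of rank one.

  Both scalar fields are treated at once, because the splitting enters only through the coordinate
  functional of a unit vector and the Pythagorean identity that this functional satisfies.
\<close>

section \<open>Orthogonal coordinates\<close>

text \<open>
  The Pythagorean identity below says that \<open>f\<close> is the orthogonal coordinate along the unit vector
  \<open>e\<close>.  Stating it through the norm leaves conjugation out of the theory, so that
  it reads the same over the real and the complex numbers.
\<close>

locale orthogonal_scaling = vector_space scale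
  for scale :: "'s::real_normed_field \<Rightarrow> 'x::real_normed_vector \<Rightarrow> 'x" +
  assumes norm_scale: "norm (scale c x) = norm c * norm x"
    and orthogonal_coordinate:
      "norm e = 1 \<Longrightarrow> \<exists>f. Vector_Spaces.linear scale (*) f \<and> f e = 1 \<and>
         (\<forall>x. (norm x)\<^sup>2 = (norm (f x))\<^sup>2 + (norm (x - scale (f x) e))\<^sup>2)"

lemma orthogonal_scaling_scaleR:
  "orthogonal_scaling (scaleR :: real \<Rightarrow> 'h::real_inner \<Rightarrow> 'h)"
proof
  fix e :: 'h assume e: "norm e = 1"
  then have ee: "e \<bullet> e = 1"
    by (simp add: dot_square_norm)
  have "(norm x)\<^sup>2 = (norm (x \<bullet> e))\<^sup>2 + (norm (x - (x \<bullet> e) *\<^sub>R e))\<^sup>2" for x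
    unfolding power2_norm_eq_inner
    by (simp add: inner_diff_left inner_diff_right ee inner_commute[of e x] power2_eq_square)
  moreover have "Vector_Spaces.linear scaleR (*) (\<lambda>x. x \<bullet> e)"
    by (simp add: Vector_Spaces.linear_iff inner_add_left real_vector.vector_space_axioms
        vector_space_over_itself.vector_space_axioms)
  ultimately show "\<exists>f. Vector_Spaces.linear (*\<^sub>R) (*) f \<and> f e = 1 \<and>
      (\<forall>x. (norm x)\<^sup>2 = (norm (f x))\<^sup>2 + (norm (x - f x *\<^sub>R e))\<^sup>2)"
    using ee by blast
qed (simp_all add: scaleR_add_right scaleR_add_left)

lemma orthogonal_scaling_scaleC:
  "orthogonal_scaling (scaleC :: complex \<Rightarrow> 'h::complex_hilbert \<Rightarrow> 'h)"
proof -
  interpret vector_space "scaleC :: complex \<Rightarrow> 'h \<Rightarrow> 'h"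
    by (rule vector_space_scaleC)
  have cinner_diff_left: "cinner (x - y) z = cinner x z - cinner y z" for x y z :: 'h
    using cinner_add_left[of "x - y" y z] by simp
  have cinner_diff_right: "cinner z (x - y) = cinner z x - cinner z y" for x y z :: 'h
    by (metis cinner_commute cinner_diff_left complex_cnj_diff)
  have cinner_scale_right: "cinner x (c *\<^sub>C y) = cnj c * cinner x y" for x y :: 'h and c
    by (metis cinner_commute cinner_scaleC_left complex_cnj_mult)
  show ?thesis
  proof
    fix c and x :: 'h
    have "complex_of_real ((norm (c *\<^sub>C x))\<^sup>2) = complex_of_real ((norm c * norm x)\<^sup>2)"
      unfolding cinner_self[symmetric]
      by (simp only: cinner_scaleC_left cinner_scale_right)
         (simp add: cinner_self power_mult_distrib complex_norm_square
           del: of_real_power)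
    then have "(norm (c *\<^sub>C x))\<^sup>2 = (norm c * norm x)\<^sup>2"
      by (simp only: of_real_eq_iff)
    then show "norm (c *\<^sub>C x) = norm c * norm x"
      by (simp add: power2_eq_iff_nonneg)
  next
    fix e :: 'h assume e: "norm e = 1"
    then have ee: "cinner e e = 1"
      by (simp add: cinner_self)
    have "(norm x)\<^sup>2 = (norm (cinner x e))\<^sup>2 + (norm (x - cinner x e *\<^sub>C e))\<^sup>2" for x
    proof -
      have "complex_of_real ((norm (x - cinner x e *\<^sub>C e))\<^sup>2)
          = cinner x x - cnj (cinner x e) * cinner x e"
        unfolding cinner_self[symmetric]
        by (simp add: cinner_diff_left cinner_diff_right cinner_scaleC_left cinner_scale_right
            ee cinner_commute[of e x])
      also have "\<dots> = complex_of_real ((norm x)\<^sup>2 - (norm (cinner x e))\<^sup>2)"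
        by (simp only: cinner_self of_real_diff complex_norm_square mult.commute)
      finally show ?thesis
        unfolding of_real_eq_iff by simp
    qed
    moreover have "Vector_Spaces.linear scaleC (*) (\<lambda>x. cinner x e)"
      by (simp add: Vector_Spaces.linear_iff cinner_add_left cinner_scaleC_left
          vector_space_scaleC vector_space_over_itself.vector_space_axioms)
    ultimately show "\<exists>f. Vector_Spaces.linear (*\<^sub>C) (*) f \<and> f e = 1 \<and>
        (\<forall>x. (norm x)\<^sup>2 = (norm (f x))\<^sup>2 + (norm (x - f x *\<^sub>C e))\<^sup>2)"
      using ee by blast
  qed
qed

text \<open>
  If \<open>v\<close> is orthogonal to \<open>e\<close>, then \<open>(L e, L v)\<close> are the coefficients of \<open>L\<close> on the plane
  of \<open>e\<close> and \<open>v\<close>; if \<open>v\<close> is a unit vector, then the sum of the squares of their moduli is at most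
  the square of the norm of \<open>L\<close>.  The proof tests \<open>L\<close> on a multiple of the vector of that plane
  that represents it.
\<close>

lemma (in orthogonal_scaling) orthogonal_value_le:
  assumes L: "Vector_Spaces.linear scale (*) L" and L_le: "\<And>x. norm (L x) \<le> norm x"
    and f: "Vector_Spaces.linear scale (*) f" and fe: "f e = 1"
    and pythagoras: "\<And>x. (norm x)\<^sup>2 = (norm (f x))\<^sup>2 + (norm (x - scale (f x) e))\<^sup>2"
    and fv: "f v = 0"
  shows "(norm (L v))\<^sup>2 \<le> (1 - (norm (L e))\<^sup>2) * (norm v)\<^sup>2"
proof -
  \<comment> \<open>\<open>conj z\<close> serves as the complex conjugate of \<open>z\<close> in an arbitrary normed field.\<close>
  define conj :: "'s \<Rightarrow> 's" where "conj z = of_real ((norm z)\<^sup>2) / z" for z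
  have mult_conj: "conj z * z = of_real ((norm z)\<^sup>2)" for z
    by (cases "z = 0") (simp_all add: conj_def)
  have norm_conj: "norm (conj z) = norm z" for z
    by (cases "z = 0") (simp_all add: conj_def norm_divide norm_power norm_mult power2_eq_square)
  define n where "n = (norm v)\<^sup>2"
  define y where "y = scale (of_real n * conj (L e)) e + scale (conj (L v)) v"
  define D where "D = (norm (L e))\<^sup>2 * n + (norm (L v))\<^sup>2"
  have n0: "n \<ge> 0" and D0: "D \<ge> 0"
    by (simp_all add: n_def D_def)
  have "L y = of_real n * (conj (L e) * L e) + conj (L v) * L v"
    using L by (simp only: y_def Vector_Spaces.linear_iff mult.assoc)
  also have "\<dots> = of_real D"
    by (simp only: mult_conj) (simp add: D_def mult.commute)
  finally have Ly: "norm (L y) = D"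
    using D0 by (simp only: norm_of_real abs_of_nonneg)
  have fy: "f y = of_real n * conj (L e)"
    using f fe fv by (simp add: y_def Vector_Spaces.linear_iff)
  have "(norm y)\<^sup>2 = (norm (of_real n * conj (L e)))\<^sup>2 + (norm (conj (L v)) * norm v)\<^sup>2"
    unfolding pythagoras[of y] fy by (simp add: y_def norm_scale)
  also have "\<dots> = n * D"
    using n0 by (simp add: norm_conj norm_mult D_def n_def power_mult_distrib algebra_simps
        power2_eq_square)
  finally have "D\<^sup>2 \<le> n * D"
    using power_mono[OF L_le[of y], of 2] D0 by (simp add: Ly)
  then have "D \<le> n"
    using D0 n0 by (cases "D = 0") (simp_all add: power2_eq_square)
  then show ?thesis
    by (simp add: D_def n_def algebra_simps)
qed

section \<open>Correcting a scalar form\<close>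

lemma bilinear_map_iff:
  "bilinear_map sX sY sZ B \<longleftrightarrow> vector_space sX \<and> vector_space sY \<and> vector_space sZ \<and>
     (\<forall>x y y'. B x (y + y') = B x y + B x y') \<and> (\<forall>x x' y. B (x + x') y = B x y + B x' y) \<and>
     (\<forall>c x y. B x (sY c y) = sZ c (B x y)) \<and> (\<forall>c x y. B (sX c x) y = sZ c (B x y))"
  unfolding bilinear_map_def Vector_Spaces.linear_iff by blast

lemma form_le_of_le_on_balls:
  assumes X: "orthogonal_scaling sX" and Y: "orthogonal_scaling sY"
    and b: "bilinear_map sX sY (*) b"
    and b_le: "\<And>x y. norm x \<le> 1 \<Longrightarrow> norm y \<le> 1 \<Longrightarrow> norm (b x y) \<le> 1"
  shows "norm (b x y) \<le> norm x * norm y"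
proof -
  interpret X: orthogonal_scaling sX by fact
  interpret Y: orthogonal_scaling sY by fact
  have scale: "b (sX c x) (sY d y) = c * (d * b x y)" for c d x y
    using b by (simp add: bilinear_map_iff)
  show ?thesis
  proof (cases "x = 0 \<or> y = 0")
    case True
    then have "b x y = 0"
      using scale[of 0 x 1 y] scale[of 1 x 0 y] by auto
    then show ?thesis by simp
  next
    case False
    let ?x = "sX (of_real (inverse (norm x))) x" and ?y = "sY (of_real (inverse (norm y))) y"
    have "norm ?x = 1" "norm ?y = 1"
      using False by (simp_all only: X.norm_scale Y.norm_scale norm_of_real) simp_all
    then have "norm (b ?x ?y) \<le> 1"
      by (simp add: b_le)
    then show ?thesis
      using False by (simp add: scale norm_mult norm_inverse norm_divide divide_simps)
  qed
qed

text \<open>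
  The corrected form keeps the corner entry of \<open>b\<close> up to its modulus and the block of \<open>b\<close> on the
  two orthogonal complements.  Its norm is at most 1 by the Cauchy-Schwarz inequality in the plane.  The bound
  \<open>1 - \<delta>\<^sup>2 / 2\<close> on the corner entry is the one that gives \<open>1 - |c|\<^sup>2 \<le> \<delta>\<^sup>2\<close>, so that each of the
  two off-diagonal blocks and the change of the corner entry cost at most \<open>\<delta>\<close>.
\<close>

lemma form_correction:
  fixes sX :: "'s::real_normed_field \<Rightarrow> 'x::real_normed_vector \<Rightarrow> 'x"
    and sY :: "'s \<Rightarrow> 'y::real_normed_vector \<Rightarrow> 'y"
  assumes X: "orthogonal_scaling sX" and Y: "orthogonal_scaling sY"
    and b: "bilinear_map sX sY (*) b" and b_le: "\<And>x y. norm (b x y) \<le> norm x * norm y"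
    and x0: "norm x\<^sub>0 = 1" and y0: "norm y\<^sub>0 = 1"
    and \<delta>: "0 < \<delta>" "\<delta> \<le> 1" and near: "norm (b x\<^sub>0 y\<^sub>0) > 1 - \<delta>\<^sup>2 / 2"
  obtains a where "bilinear_map sX sY (*) a" "\<And>x y. norm (a x y) \<le> norm x * norm y"
    "norm (a x\<^sub>0 y\<^sub>0) = 1" "\<And>x y. norm (a x y - b x y) \<le> 3 * \<delta> * (norm x * norm y)"
proof -
  interpret X: orthogonal_scaling sX by fact
  interpret Y: orthogonal_scaling sY by fact
  obtain f where f: "Vector_Spaces.linear sX (*) f" and fx0: "f x\<^sub>0 = 1"
    and pf: "\<And>x. (norm x)\<^sup>2 = (norm (f x))\<^sup>2 + (norm (x - sX (f x) x\<^sub>0))\<^sup>2"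
    using X.orthogonal_coordinate[OF x0] by blast
  obtain g where g: "Vector_Spaces.linear sY (*) g" and gy0: "g y\<^sub>0 = 1"
    and pg: "\<And>y. (norm y)\<^sup>2 = (norm (g y))\<^sup>2 + (norm (y - sY (g y) y\<^sub>0))\<^sup>2"
    using Y.orthogonal_coordinate[OF y0] by blast
  define u where "u x = x - sX (f x) x\<^sub>0" for x
  define v where "v y = y - sY (g y) y\<^sub>0" for y
  define c where "c = b x\<^sub>0 y\<^sub>0"
  define w where "w = c / of_real (norm c)"
  define a where "a x y = f x * g y * w + b (u x) (v y)" for x y
  have \<delta>2: "\<delta>\<^sup>2 \<le> \<delta>"
    using \<delta> by (simp add: power2_eq_square)
  have c1: "norm c \<le> 1"
    using b_le[of x\<^sub>0 y\<^sub>0] by (simp add: c_def x0 y0)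
  have c_near: "norm c > 1 - \<delta>\<^sup>2 / 2"
    using near by (simp add: c_def)
  then have c0: "c \<noteq> 0"
    using \<delta> \<delta>2 by auto
  have w1: "norm w = 1"
    using c0 by (simp add: w_def norm_divide)
  have f_lin: "f (x + x') = f x + f x'" "f (sX k x) = k * f x" for x x' k
    using f by (simp_all add: Vector_Spaces.linear_iff)
  have g_lin: "g (y + y') = g y + g y'" "g (sY k y) = k * g y" for y y' k
    using g by (simp_all add: Vector_Spaces.linear_iff)
  have b_lin: "b x (y + y') = b x y + b x y'" "b (x + x') y = b x y + b x' y"
    "b x (sY k y) = k * b x y" "b (sX k x) y = k * b x y" for x x' y y' k
    using b by (simp_all add: bilinear_map_iff)
  have u_lin: "u (x + x') = u x + u x'" "u (sX k x) = sX k (u x)" for x x' k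
    by (simp_all add: u_def f_lin X.scale_left_distrib X.scale_right_diff_distrib)
  have v_lin: "v (y + y') = v y + v y'" "v (sY k y) = sY k (v y)" for y y' k
    by (simp_all add: v_def g_lin Y.scale_left_distrib Y.scale_right_diff_distrib)
  have fu: "f (u x) = 0" for x
    using f_lin(1)[of "u x" "sX (f x) x\<^sub>0"] by (simp add: f_lin fx0 u_def)
  have gv: "g (v y) = 0" for y
    using g_lin(1)[of "v y" "sY (g y) y\<^sub>0"] by (simp add: g_lin gy0 v_def)
  have f_le: "norm (f x) \<le> norm x" and u_le: "norm (u x) \<le> norm x" for x
    unfolding u_def by (rule power2_le_imp_le; simp add: pf[of x])+
  have g_le: "norm (g y) \<le> norm y" and v_le: "norm (v y) \<le> norm y" for y
    unfolding v_def by (rule power2_le_imp_le; simp add: pg[of y])+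
  have a_bil: "bilinear_map sX sY (*) a"
    unfolding bilinear_map_iff
    by (simp add: a_def f_lin g_lin u_lin v_lin b_lin algebra_simps
        X.vector_space_axioms Y.vector_space_axioms vector_space_over_itself.vector_space_axioms)
  have a_le: "norm (a x y) \<le> norm x * norm y" for x y
  proof -
    have "norm (a x y) \<le> norm (f x) * norm (g y) + norm (u x) * norm (v y)"
      unfolding a_def using b_le[of "u x" "v y"]
      by (intro order_trans[OF norm_triangle_ineq] add_mono) (simp_all add: norm_mult w1)
    also have "\<dots> \<le> norm x * norm y"
    proof (rule power2_le_imp_le)
      \<comment> \<open>Lagrange's identity for the vectors of norms of the orthogonal components.\<close>
      have "(norm x * norm y)\<^sup>2 - (norm (f x) * norm (g y) + norm (u x) * norm (v y))\<^sup>2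
          = (norm (f x) * norm (v y) - norm (u x) * norm (g y))\<^sup>2"
        unfolding power_mult_distrib pf[of x] pg[of y] u_def[symmetric] v_def[symmetric]
        by (simp add: power2_eq_square algebra_simps)
      then show "(norm (f x) * norm (g y) + norm (u x) * norm (v y))\<^sup>2 \<le> (norm x * norm y)\<^sup>2"
        by (smt (verit) zero_le_power2)
    qed simp
    finally show ?thesis .
  qed
  have "u x\<^sub>0 = 0" "v y\<^sub>0 = 0"
    by (simp_all add: u_def v_def fx0 gy0)
  then have "b (u x\<^sub>0) (v y\<^sub>0) = 0"
    using b_lin(3)[of "u x\<^sub>0" 0 0] by simp
  then have a1: "norm (a x\<^sub>0 y\<^sub>0) = 1"
    by (simp add: a_def fx0 gy0 w1)
  have gap: "1 - (norm c)\<^sup>2 \<le> \<delta>\<^sup>2"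
  proof -
    have "1 - (norm c)\<^sup>2 = (1 - norm c) * (1 + norm c)"
      by (simp add: power2_eq_square algebra_simps)
    also have "\<dots> \<le> (1 - norm c) * 2"
      using c1 by (intro mult_left_mono) auto
    finally show ?thesis
      using c_near by simp
  qed
  have b_x0: "norm (b x\<^sub>0 (v y)) \<le> \<delta> * norm y" for y
  proof (rule power2_le_imp_le)
    have "Vector_Spaces.linear sY (*) (b x\<^sub>0)"
      using b by (simp add: bilinear_map_def)
    then have "(norm (b x\<^sub>0 (v y)))\<^sup>2 \<le> (1 - (norm c)\<^sup>2) * (norm (v y))\<^sup>2"
      unfolding c_def using b_le[of x\<^sub>0] x0
      by (intro Y.orthogonal_value_le[OF _ _ g gy0 pg gv]) auto
    also have "\<dots> \<le> \<delta>\<^sup>2 * (norm y)\<^sup>2"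
      using gap v_le[of y] by (intro mult_mono power_mono) auto
    finally show "(norm (b x\<^sub>0 (v y)))\<^sup>2 \<le> (\<delta> * norm y)\<^sup>2"
      by (simp add: power_mult_distrib)
  qed (use \<delta> in auto)
  have b_y0: "norm (b (u x) y\<^sub>0) \<le> \<delta> * norm x" for x
  proof (rule power2_le_imp_le)
    have "Vector_Spaces.linear sX (*) (\<lambda>x. b x y\<^sub>0)"
      using b by (simp add: bilinear_map_def)
    then have "(norm (b (u x) y\<^sub>0))\<^sup>2 \<le> (1 - (norm c)\<^sup>2) * (norm (u x))\<^sup>2"
      unfolding c_def using b_le[of _ y\<^sub>0] y0
      by (intro X.orthogonal_value_le[OF _ _ f fx0 pf fu]) auto
    also have "\<dots> \<le> \<delta>\<^sup>2 * (norm x)\<^sup>2"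
      using gap u_le[of x] by (intro mult_mono power_mono) auto
    finally show "(norm (b (u x) y\<^sub>0))\<^sup>2 \<le> (\<delta> * norm x)\<^sup>2"
      by (simp add: power_mult_distrib)
  qed (use \<delta> in auto)
  have w_c: "norm (w - c) \<le> \<delta>"
  proof -
    have "w - c = w * of_real (1 - norm c)"
      using c0 by (simp add: w_def field_simps)
    then have "norm (w - c) = 1 - norm c"
      using c1 by (simp only: norm_mult w1 norm_of_real) simp
    then show ?thesis
      using c_near \<delta> \<delta>2 by linarith
  qed
  have "norm (a x y - b x y) \<le> 3 * \<delta> * (norm x * norm y)" for x y
  proof -
    have "b x y = b (sX (f x) x\<^sub>0 + u x) (sY (g y) y\<^sub>0 + v y)"
      by (simp add: u_def v_def)
    also have "\<dots> = f x * g y * c + f x * b x\<^sub>0 (v y) + g y * b (u x) y\<^sub>0 + b (u x) (v y)"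
      unfolding b_lin by (simp add: c_def algebra_simps)
    finally have "a x y - b x y = f x * g y * (w - c) + (- (f x * b x\<^sub>0 (v y)) - g y * b (u x) y\<^sub>0)"
      by (simp add: a_def algebra_simps)
    then have "norm (a x y - b x y) \<le> norm (f x * g y * (w - c))
        + (norm (f x * b x\<^sub>0 (v y)) + norm (g y * b (u x) y\<^sub>0))"
      by (metis norm_triangle_ineq norm_triangle_ineq4 norm_minus_cancel add_left_mono order_trans)
    also have "\<dots> \<le> norm x * norm y * \<delta> + (norm x * (\<delta> * norm y) + norm y * (\<delta> * norm x))"
      unfolding norm_mult using w_c b_x0[of y] b_y0[of x] f_le[of x] g_le[of y] \<delta>
      by (intro add_mono mult_mono) auto
    also have "\<dots> = 3 * \<delta> * (norm x * norm y)"
      by (simp add: algebra_simps)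
    finally show ?thesis .
  qed
  with a_bil a_le a1 show thesis
    by (rule that)
qed

section \<open>Localising the correction at a point\<close>

text \<open>
  A compact set of continuous functions is equicontinuous, so its members vary little near \<open>s\<close>.
  The bump is written down from a finite net of the set, which also makes it continuous for free.
\<close>

lemma bump_function:
  fixes S :: "('k::topological_space \<Rightarrow>\<^sub>C 's::real_normed_vector) set"
  assumes S: "compact S" and \<delta>: "\<delta> > 0"
  obtains \<phi> :: "'k \<Rightarrow>\<^sub>C real" where "\<phi> s = 1" "\<And>t. 0 \<le> \<phi> t" "\<And>t. \<phi> t \<le> 1"
    "\<And>t f. \<phi> t \<noteq> 0 \<Longrightarrow> f \<in> S \<Longrightarrow> norm (f t - f s) \<le> \<delta>"
proof -
  from S \<delta> obtain N where N: "finite N" "S \<subseteq> (\<Union>g\<in>N. ball g (\<delta> / 3))"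
    unfolding compact_eq_totally_bounded by (metis zero_less_divide_iff zero_less_numeral)
  define p :: "'k \<Rightarrow> real"
    where "p t = max 0 (1 - (\<Sum>g\<in>N. norm (apply_bcontfun g t - apply_bcontfun g s)) / (\<delta> / 3))" for t
  have sum0: "0 \<le> (\<Sum>g\<in>N. norm (apply_bcontfun g t - apply_bcontfun g s)) / (\<delta> / 3)" for t
    using \<delta> by (simp add: sum_nonneg)
  have p01: "0 \<le> p t" "p t \<le> 1" for t
    using sum0[of t] by (simp_all add: p_def)
  have "continuous_on UNIV p"
    unfolding p_def by (intro continuous_intros continuous_on_apply_bcontfun) (use \<delta> in auto)
  then have "p \<in> bcontfun"
    using p01 by (intro bcontfun_normI[where b = 1]) auto
  then obtain \<phi> where \<phi>: "apply_bcontfun \<phi> = p"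
    by (metis Bcontfun_inverse)
  show thesis
  proof (rule that[of \<phi>])
    show "norm (f t - f s) \<le> \<delta>" if "\<phi> t \<noteq> 0" "f \<in> S" for t f
    proof -
      obtain g where g: "g \<in> N" "dist g f < \<delta> / 3"
        using N \<open>f \<in> S\<close> by auto
      have "(\<Sum>g\<in>N. norm (apply_bcontfun g t - apply_bcontfun g s)) < \<delta> / 3"
        using \<open>\<phi> t \<noteq> 0\<close> \<delta> by (simp add: \<phi> p_def max_def divide_simps split: if_splits)
      moreover have "norm (g t - g s) \<le> (\<Sum>g\<in>N. norm (apply_bcontfun g t - apply_bcontfun g s))"
        using g N by (intro member_le_sum) auto
      moreover have "dist (g t) (f t) < \<delta> / 3" "dist (g s) (f s) < \<delta> / 3"
        using g dist_bounded[of g _ f] by (meson order.strict_trans1)+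
      ultimately show ?thesis
        using dist_triangle[of "f t" "f s" "g t"] dist_triangle[of "g t" "f s" "g s"]
        by (simp add: dist_norm norm_minus_commute)
    qed
  qed (use p01 in \<open>auto simp: \<phi> p_def\<close>)
qed

context includes bcontfun.lifting
begin

lift_definition mult_bcontfun ::
    "('k::topological_space \<Rightarrow>\<^sub>C real) \<Rightarrow> ('k \<Rightarrow>\<^sub>C 's::real_normed_vector) \<Rightarrow> ('k \<Rightarrow>\<^sub>C 's)"
  is "\<lambda>\<phi> f t. \<phi> t *\<^sub>R f t"
proof -
  fix \<phi> :: "'k \<Rightarrow> real" and f :: "'k \<Rightarrow> 's"
  assume "\<phi> \<in> bcontfun" "f \<in> bcontfun"
  then obtain M N where "continuous_on UNIV \<phi>" "continuous_on UNIV f"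
    "\<And>t. norm (\<phi> t) \<le> M" "\<And>t. norm (f t) \<le> N"
    unfolding bcontfun_def bounded_iff by auto
  then show "(\<lambda>t. \<phi> t *\<^sub>R f t) \<in> bcontfun"
    by (intro bcontfun_normI[where b = "M * N"] continuous_intros)
       (auto intro!: mult_mono intro: order_trans[OF abs_ge_zero])
qed

end

lemma continuous_on_mult_bcontfun:
  "continuous_on A (mult_bcontfun \<phi>)"
proof -
  have "dist (mult_bcontfun \<phi> f) (mult_bcontfun \<phi> g) \<le> norm \<phi> * dist f g" for f g
  proof (rule dist_bound)
    fix t
    have "dist (mult_bcontfun \<phi> f t) (mult_bcontfun \<phi> g t) = \<bar>\<phi> t\<bar> * dist (f t) (g t)"
      by (simp add: mult_bcontfun.rep_eq dist_norm flip: scaleR_diff_right)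
    also have "\<dots> \<le> norm \<phi> * dist f g"
      using norm_bounded[of \<phi> t] by (intro mult_mono dist_bounded) auto
    finally show "dist (mult_bcontfun \<phi> f t) (mult_bcontfun \<phi> g t) \<le> norm \<phi> * dist f g" .
  qed
  then show ?thesis
    by (intro lipschitz_on_continuous_on[of "norm \<phi>"] lipschitz_onI) auto
qed

lemma continuous_on_const_bcontfun: "continuous_on A const_bcontfun"
proof -
  have "dist (const_bcontfun c) (const_bcontfun d) \<le> 1 * dist c d" for c d
    by (rule dist_bound) (simp add: const_bcontfun.rep_eq)
  then show ?thesis
    by (intro lipschitz_on_continuous_on[of 1] lipschitz_onI) auto
qed

lemma compact_bilinear_norm_le:
  assumes "B \<in> compact_bilinear sX sY sZ" "norm x \<le> 1" "norm y \<le> 1"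
  shows "norm (B x y) \<le> bilinear_norm B"
proof -
  let ?I = "(\<lambda>(x, y). B x y) ` (cball 0 1 \<times> cball 0 1)"
  have "bounded ?I"
    using assms(1)
    by (intro bounded_subset[OF compact_imp_bounded closure_subset])
       (simp add: compact_bilinear_def)
  then have "bdd_above (norm ` ?I)"
    by (simp add: bdd_above_norm)
  then show ?thesis
    unfolding bilinear_norm_def using assms
    by (intro cSUP_upper2[where x = "(x, y)"]) (auto simp: image_image case_prod_unfold)
qed

section \<open>The point property\<close>

text \<open>
  The perturbation costs \<open>3 * \<delta>\<close> for the correction of the form at the point \<open>s\<close>, and
  another \<open>\<delta>\<close> for the variation of \<open>t \<mapsto> B\<^sub>t\<close> on the support of the bump.
\<close>

theorem BPBpp_compact_bilinear_bcontfun: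
  fixes sX :: "'s::{real_normed_field, heine_borel} \<Rightarrow> 'x::real_normed_vector \<Rightarrow> 'x"
    and sY :: "'s \<Rightarrow> 'y::real_normed_vector \<Rightarrow> 'y"
  assumes X: "orthogonal_scaling sX" and Y: "orthogonal_scaling sY"
  shows "BPBpp_compact_bilinear sX sY
    (scale_bcontfun :: 's \<Rightarrow> ('k::topological_space \<Rightarrow>\<^sub>C 's) \<Rightarrow> ('k \<Rightarrow>\<^sub>C 's))"
  unfolding BPBpp_compact_bilinear_def
proof (intro allI impI)
  fix \<epsilon> :: real assume \<epsilon>: "\<epsilon> > 0"
  define \<delta> where "\<delta> = min 1 (\<epsilon> / 8)"
  have \<delta>: "0 < \<delta>" "\<delta> \<le> 1" "4 * \<delta> < \<epsilon>"
    using \<epsilon> by (auto simp: \<delta>_def min_def)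
  let ?sZ = "scale_bcontfun :: 's \<Rightarrow> ('k \<Rightarrow>\<^sub>C 's) \<Rightarrow> ('k \<Rightarrow>\<^sub>C 's)"
  have "\<exists>A \<in> compact_bilinear sX sY ?sZ.
      bilinear_norm A = 1 \<and> norm (A x\<^sub>0 y\<^sub>0) = 1 \<and> bilinear_norm (\<lambda>x y. A x y - B x y) < \<epsilon>"
    if B: "B \<in> compact_bilinear sX sY ?sZ" and x0: "norm x\<^sub>0 = 1" and y0: "norm y\<^sub>0 = 1"
      and B1: "bilinear_norm B = 1" and near: "norm (B x\<^sub>0 y\<^sub>0) > 1 - \<delta>\<^sup>2 / 2" for B x\<^sub>0 y\<^sub>0
  proof -
    let ?ball = "cball 0 1 \<times> cball 0 1 :: ('x \<times> 'y) set"
    define S where "S = closure ((\<lambda>(x, y). B x y) ` ?ball)"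
    have S: "compact S" and B_bil: "bilinear_map sX sY ?sZ B"
      using B by (simp_all add: compact_bilinear_def S_def)
    have B_S: "B x y \<in> S" if "norm x \<le> 1" "norm y \<le> 1" for x y
      unfolding S_def using that by (intro subsetD[OF closure_subset]) force
    have B_lin: "B x (y + y') = B x y + B x y'" "B (x + x') y = B x y + B x' y"
      "B x (sY k y) = ?sZ k (B x y)" "B (sX k x) y = ?sZ k (B x y)" for x x' y y' k
      using B_bil by (simp_all add: bilinear_map_iff)
    have form: "bilinear_map sX sY (*) (\<lambda>x y. B x y t)" for t
      using B_bil
      by (simp add: bilinear_map_iff scale_bcontfun.rep_eq
          vector_space_over_itself.vector_space_axioms)
    have form_le: "norm (B x y t) \<le> norm x * norm y" for x y t
      using X Y form
    proof (rule form_le_of_le_on_balls)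
      show "norm (B x y t) \<le> 1" if "norm x \<le> 1" "norm y \<le> 1" for x y
        using norm_bounded[of "B x y" t] compact_bilinear_norm_le[OF B that] B1 by linarith
    qed
    obtain s where s: "norm (B x\<^sub>0 y\<^sub>0 s) > 1 - \<delta>\<^sup>2 / 2"
      using near norm_bound[of "B x\<^sub>0 y\<^sub>0" "1 - \<delta>\<^sup>2 / 2"] by (meson linorder_not_less)
    obtain a where a: "bilinear_map sX sY (*) a"
      and a_le: "\<And>x y. norm (a x y) \<le> norm x * norm y" and a1: "norm (a x\<^sub>0 y\<^sub>0) = 1"
      and a_B: "\<And>x y. norm (a x y - B x y s) \<le> 3 * \<delta> * (norm x * norm y)"
      using form_correction[OF X Y form[of s] form_le x0 y0 \<delta>(1,2) s] by metis
    obtain \<phi> :: "'k \<Rightarrow>\<^sub>C real" where \<phi>: "\<phi> s = 1" "\<And>t. 0 \<le> \<phi> t" "\<And>t. \<phi> t \<le> 1"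
      and \<phi>_near: "\<And>t f. \<phi> t \<noteq> 0 \<Longrightarrow> f \<in> S \<Longrightarrow> norm (f t - f s) \<le> \<delta>"
      using bump_function[OF S \<delta>(1), of s] by metis
    \<comment> \<open>\<open>C f c\<close> is the pointwise convex combination \<open>(1 - \<phi>) f + \<phi> c\<close>.  As it is jointly continuous
      in \<open>f\<close> and \<open>c\<close>, it maps the compact set of all \<open>f\<close> in \<open>S\<close> and all \<open>c\<close> in the unit disc onto a
      compact set, and this is why \<open>A\<close> is compact.\<close>
    define C where "C f c = f + mult_bcontfun \<phi> (const_bcontfun c - f)" for f :: "'k \<Rightarrow>\<^sub>C 's" and c
    define A where "A x y = C (B x y) (a x y)" for x y
    have A_eval: "A x y t = B x y t + \<phi> t *\<^sub>R (a x y - B x y t)" for x y t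
      by (simp add: A_def C_def mult_bcontfun.rep_eq const_bcontfun.rep_eq)
    have A_bil: "bilinear_map sX sY ?sZ A"
      using a B_bil unfolding bilinear_map_iff
      by (auto intro!: bcontfun_eqI simp: A_eval B_lin scale_bcontfun.rep_eq
          scaleR_conv_of_real algebra_simps)
    have A_le: "norm (A x y) \<le> 1" if xy: "norm x \<le> 1" "norm y \<le> 1" for x y
    proof (rule norm_bound)
      fix t
      have le1: "norm x * norm y \<le> 1"
        using xy by (simp add: mult_le_one)
      have "A x y t = (1 - \<phi> t) *\<^sub>R B x y t + \<phi> t *\<^sub>R a x y"
        by (simp add: A_eval algebra_simps)
      then have "norm (A x y t) \<le> (1 - \<phi> t) * norm (B x y t) + \<phi> t * norm (a x y)"
        using norm_triangle_ineq[of "(1 - \<phi> t) *\<^sub>R B x y t" "\<phi> t *\<^sub>R a x y"] \<phi>(2,3)[of t] by simp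
      also have "\<dots> \<le> (1 - \<phi> t) * 1 + \<phi> t * 1"
        using \<phi>(2,3)[of t] form_le[of x y t] a_le[of x y] le1
        by (intro add_mono mult_left_mono) auto
      finally show "norm (A x y t) \<le> 1" by simp
    qed
    have A_B: "norm (A x y - B x y) \<le> 4 * \<delta>" if xy: "norm x \<le> 1" "norm y \<le> 1" for x y
    proof (rule norm_bound)
      fix t
      have eq: "norm ((A x y - B x y) t) = \<phi> t * norm (a x y - B x y t)"
        using \<phi>(2)[of t] by (simp add: A_eval)
      show "norm ((A x y - B x y) t) \<le> 4 * \<delta>"
      proof (cases "\<phi> t = 0")
        case True
        then show ?thesis unfolding eq using \<delta> by simp
      next
        case False
        have "3 * \<delta> * (norm x * norm y) \<le> 3 * \<delta>"
          using \<delta> xy by (simp add: mult_le_one)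
        then have "norm (a x y - B x y s) \<le> 3 * \<delta>"
          using a_B[of x y] by linarith
        moreover have "norm (B x y t - B x y s) \<le> \<delta>"
          by (rule \<phi>_near[OF False B_S[OF xy]])
        ultimately have "norm (a x y - B x y t) \<le> 4 * \<delta>"
          using norm_triangle_ineq4[of "a x y - B x y s" "B x y t - B x y s"] by simp
        then show ?thesis
          unfolding eq using \<phi>(2,3)[of t] mult_left_le_one_le[of "norm (a x y - B x y t)" "\<phi> t"]
          by simp
      qed
    qed
    have "compact (closure ((\<lambda>(x, y). A x y) ` ?ball))"
    proof -
      let ?T = "(\<lambda>(f, c). C f c) ` (S \<times> cball 0 1)"
      have "continuous_on (S \<times> cball 0 1) (\<lambda>(f, c). C f c)"
        unfolding C_def case_prod_unfold
        by (intro continuous_intros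
            continuous_on_compose2[OF continuous_on_mult_bcontfun[of UNIV]]
            continuous_on_compose2[OF continuous_on_const_bcontfun[of UNIV]]) auto
      then have T: "compact ?T"
        using S by (intro compact_continuous_image compact_Times) auto
      have "A x y \<in> ?T" if xy: "norm x \<le> 1" "norm y \<le> 1" for x y
      proof -
        have "norm (a x y) \<le> 1"
          using a_le[of x y] xy mult_le_one[of "norm x" "norm y"] by simp
        then show ?thesis
          unfolding A_def using B_S[OF xy] by force
      qed
      then have "(\<lambda>(x, y). A x y) ` ?ball \<subseteq> ?T"
        by auto
      then have "closure ((\<lambda>(x, y). A x y) ` ?ball) \<subseteq> ?T"
        using T by (intro closure_minimal compact_imp_closed)
      then show ?thesis
        using T by (metis closed_closure compact_Int_closed inf.absorb2)
    qed
    then have A: "A \<in> compact_bilinear sX sY ?sZ"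
      using A_bil by (simp add: compact_bilinear_def)
    have "A x\<^sub>0 y\<^sub>0 s = a x\<^sub>0 y\<^sub>0"
      by (simp add: A_eval \<phi>)
    then have attained: "norm (A x\<^sub>0 y\<^sub>0) = 1"
      using norm_bounded[of "A x\<^sub>0 y\<^sub>0" s] A_le[of x\<^sub>0 y\<^sub>0] by (simp add: a1 x0 y0)
    have "bilinear_norm A \<le> 1"
      unfolding bilinear_norm_def using A_le by (intro cSUP_least) auto
    moreover have "bilinear_norm A \<ge> 1"
      using compact_bilinear_norm_le[OF A, of x\<^sub>0 y\<^sub>0] by (simp add: attained x0 y0)
    moreover have "bilinear_norm (\<lambda>x y. A x y - B x y) \<le> 4 * \<delta>"
      unfolding bilinear_norm_def using A_B by (intro cSUP_least) auto
    ultimately show ?thesis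
      using A attained \<delta> by (intro bexI[of _ A]) auto
  qed
  then show "\<exists>\<eta>>0. \<forall>B \<in> compact_bilinear sX sY ?sZ. \<forall>x\<^sub>0 \<in> sphere 0 1. \<forall>y\<^sub>0 \<in> sphere 0 1.
      bilinear_norm B = 1 \<and> norm (B x\<^sub>0 y\<^sub>0) > 1 - \<eta> \<longrightarrow>
      (\<exists>A \<in> compact_bilinear sX sY ?sZ.
         bilinear_norm A = 1 \<and> norm (A x\<^sub>0 y\<^sub>0) = 1 \<and>
         bilinear_norm (\<lambda>x y. A x y - B x y) < \<epsilon>)"
    using \<delta> by (intro exI[of _ "\<delta>\<^sup>2 / 2"]) simp
qed

theorem corollary3p7:
  assumes "compact (UNIV :: 'k::t2_space set)"
  shows
    "BPBpp_compact_bilinear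
       (scaleR :: real \<Rightarrow> 'h1::{real_inner, complete_space} \<Rightarrow> 'h1)
       (scaleR :: real \<Rightarrow> 'h2::{real_inner, complete_space} \<Rightarrow> 'h2)
       (scaleR :: real \<Rightarrow> ('k \<Rightarrow>\<^sub>C real) \<Rightarrow> ('k \<Rightarrow>\<^sub>C real)) \<and>
     BPBpp_compact_bilinear
       (scaleC :: complex \<Rightarrow> 'c1::complex_hilbert \<Rightarrow> 'c1)
       (scaleC :: complex \<Rightarrow> 'c2::complex_hilbert \<Rightarrow> 'c2)
       (scale_bcontfun :: complex \<Rightarrow> ('k \<Rightarrow>\<^sub>C complex) \<Rightarrow> ('k \<Rightarrow>\<^sub>C complex))"
  by (intro conjI BPBpp_compact_bilinear_bcontfun[OF orthogonal_scaling_scaleR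
        orthogonal_scaling_scaleR, unfolded scale_bcontfun_real]
      BPBpp_compact_bilinear_bcontfun[OF orthogonal_scaling_scaleC orthogonal_scaling_scaleC])

end
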